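(* Let $p>2$ be a prime and let $M_p$ be a linearly ordered set with $p$ elements, made into a monoid under the meet (minimum) operation. Then $M_p$ is an idempotent commutative monoid which is not isomorphic to the sandpile monoid $\mathcal{M}(\widehat{X})$ of any sandpile graph $\widehat{X}$.
   Context: A sandpile graph $\widehat{X}$ is a finite weakly connected directed multigraph (loops and multiple edges allowed) with a distinguished vertex, the sink, reachable by a directed path from every vertex; the set of non-sink vertices is nonempty. A configuration assigns a nonnegative integer number of grains to each non-sink vertex; it is stable if every $v$ holds fewer than $\deg^{+}(v)$ (out-degree) grains. Toppling an unstable vertex sends one grain along each of its out-edges (grains at the sink vanish; the sink never topples); every configuration has a unique stabilization. The sandpile monoid $\mathcal{M}(\widehat X)$ is the set of stable configurations with $a\oplus b$ = stabilization of the pointwise sum $a+b$. *)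

theory Defs
  imports
    "HOL-Algebra.Group"
    "HOL-Computational_Algebra.Primes"
    "Graph_Theory.Graph_Theory"
begin

text \<open>
  Arcs are named objects in a \<^typ>\<open>('v, 'e) pre_digraph\<close>, so \<^locale>\<open>fin_digraph\<close> allows loops and
  multiple edges. \<^const>\<open>Digraph_Component.connected\<close> is weak connectedness: it symmetrises the arc
  relation first. The sink may have outgoing arcs; they play no role below.
\<close>

locale sandpile_graph = fin_digraph G for G :: "('v, 'e) pre_digraph" (structure) +
  fixes sink :: 'v
  assumes sink_in_verts: "sink \<in> verts G"
    and weakly_connected: "Digraph_Component.connected G"
    and sink_reachable: "v \<in> verts G \<Longrightarrow> v \<rightarrow>\<^sup>*\<^bsub>G\<^esub> sink"
    and nonsink_nonempty: "verts G - {sink} \<noteq> {}"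

definition nonsink :: "('v, 'e) pre_digraph \<Rightarrow> 'v \<Rightarrow> 'v set" where
  "nonsink G sink = verts G - {sink}"

text \<open>
  A configuration is a function on the non-sink vertices. It is extended by 0 to the whole vertex
  type, so that equality of configurations is equality of functions.
\<close>

definition configs :: "('v, 'e) pre_digraph \<Rightarrow> 'v \<Rightarrow> ('v \<Rightarrow> nat) set" where
  "configs G sink = {c. \<forall>v. v \<notin> nonsink G sink \<longrightarrow> c v = 0}"

definition stable :: "('v, 'e) pre_digraph \<Rightarrow> 'v \<Rightarrow> ('v \<Rightarrow> nat) \<Rightarrow> bool" where
  "stable G sink c \<longleftrightarrow> (\<forall>v\<in>nonsink G sink. c v < out_degree G v)"

text \<open>
  The subtraction below is only used for a vertex \<open>v\<close> holding at least \<^term>\<open>out_degree G v\<close> grains.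
  A loop at \<open>v\<close> returns its grain to \<open>v\<close>.
\<close>

definition topple :: "('v, 'e) pre_digraph \<Rightarrow> 'v \<Rightarrow> 'v \<Rightarrow> ('v \<Rightarrow> nat) \<Rightarrow> ('v \<Rightarrow> nat)" where
  "topple G sink v c = (\<lambda>u.
     if u \<in> nonsink G sink
     then (if u = v then c u - out_degree G v else c u) + card {e \<in> out_arcs G v. head G e = u}
     else 0)"

definition topples_to :: "('v, 'e) pre_digraph \<Rightarrow> 'v \<Rightarrow> ('v \<Rightarrow> nat) \<Rightarrow> ('v \<Rightarrow> nat) \<Rightarrow> bool" where
  "topples_to G sink c c' \<longleftrightarrow>
     (\<exists>v\<in>nonsink G sink. out_degree G v \<le> c v \<and> c' = topple G sink v c)"

definition stabilization :: "('v, 'e) pre_digraph \<Rightarrow> 'v \<Rightarrow> ('v \<Rightarrow> nat) \<Rightarrow> ('v \<Rightarrow> nat)" where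
  "stabilization G sink c = (THE s. (topples_to G sink)\<^sup>*\<^sup>* c s \<and> stable G sink s)"

definition sandpile_monoid :: "('v, 'e) pre_digraph \<Rightarrow> 'v \<Rightarrow> ('v \<Rightarrow> nat) monoid" where
  "sandpile_monoid G sink =
     \<lparr>carrier = {c \<in> configs G sink. stable G sink c},
      monoid.mult = (\<lambda>a b. stabilization G sink (\<lambda>v. a v + b v)),
      one = (\<lambda>v. 0)\<rparr>"

definition meet_monoid :: "('a, 'b) gorder_scheme \<Rightarrow> 'a monoid" where
  "meet_monoid L = \<lparr>carrier = carrier L, monoid.mult = meet L, one = \<top>\<^bsub>L\<^esub>\<rparr>"

end

theory Submission
  imports Defs
begin

text \<open>
  There are as many stable configurations as the product of the out-degrees of the non-sink
  vertices. If this number is a prime \<open>p > 2\<close>, some out-degree is divisible by \<open>p\<close> and hence exceeds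
  2. One grain plus one grain at such a vertex is two grains, which is already stable; so a single
  grain there is not an idempotent, whereas every element of a meet monoid is.
\<close>

text \<open>Stability bounds the entry at each vertex independently, so stable configurations form a
  product of intervals.\<close>

lemma card_sandpile_monoid:
  assumes "finite (verts G)"
  shows "card (carrier (sandpile_monoid G sink)) = (\<Prod>v\<in>nonsink G sink. out_degree G v)"
proof -
  let ?N = "nonsink G sink"
  have "bij_betw (\<lambda>c. restrict c ?N) (carrier (sandpile_monoid G sink))
          (\<Pi>\<^sub>E v\<in>?N. {..<out_degree G v})"
    \<comment> \<open>\<open>restrict\<close> yields \<open>undefined\<close> off \<open>?N\<close>,
      where a configuration is 0; the inverse map \<open>f'\<close> puts the 0 back.\<close>
    by (rule bij_betw_byWitness[where f' = "\<lambda>c v. if v \<in> ?N then c v else 0"])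
       (fastforce simp: sandpile_monoid_def configs_def stable_def PiE_iff extensional_def)+
  then have "card (carrier (sandpile_monoid G sink)) = card (\<Pi>\<^sub>E v\<in>?N. {..<out_degree G v})"
    by (rule bij_betw_same_card)
  also have "\<dots> = (\<Prod>v\<in>?N. out_degree G v)"
    using assms by (simp add: card_PiE nonsink_def)
  finally show ?thesis .
qed

text \<open>No vertex can topple in a stable configuration, so only \<open>c\<close> itself is
  reachable from \<open>c\<close>, and the \<open>THE\<close> in \<open>stabilization\<close> picks
  it.\<close>

lemma stabilization_stable:
  assumes "stable G sink c"
  shows "stabilization G sink c = c"
proof -
  have "\<not> topples_to G sink c c'" for c'
    using assms by (force simp: stable_def topples_to_def)
  then have "(topples_to G sink)\<^sup>*\<^sup>* c s \<longleftrightarrow> s = c" for s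
    by (auto elim: converse_rtranclpE)
  then show ?thesis
    using assms by (auto simp: stabilization_def intro!: the_equality)
qed

text \<open>Stability is a strict bound, so \<open>pos\<close> is what makes the vertices without
  grains stable.\<close>

lemma sandpile_monoid_not_idempotent:
  assumes v: "v \<in> nonsink G sink" "2 < out_degree G v"
    and pos: "\<And>u. u \<in> nonsink G sink \<Longrightarrow> 0 < out_degree G u"
  shows "\<exists>c\<in>carrier (sandpile_monoid G sink). c \<otimes>\<^bsub>sandpile_monoid G sink\<^esub> c \<noteq> c"
proof
  define c where "c = (\<lambda>u. if u = v then 1 else 0 :: nat)"
  show "c \<in> carrier (sandpile_monoid G sink)"
    using v pos by (auto simp: sandpile_monoid_def configs_def stable_def c_def)
  have "stable G sink (\<lambda>u. c u + c u)"
    using v pos by (auto simp: stable_def c_def)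
  then have "c \<otimes>\<^bsub>sandpile_monoid G sink\<^esub> c = (\<lambda>u. c u + c u)"
    by (simp add: sandpile_monoid_def stabilization_stable)
  moreover have "c v + c v \<noteq> c v"
    by (simp add: c_def)
  ultimately show "c \<otimes>\<^bsub>sandpile_monoid G sink\<^esub> c \<noteq> c"
    by (metis (full_types))
qed

lemma iso_preserves_idempotent:
  assumes "M \<cong> N" and idem: "\<And>x. x \<in> carrier M \<Longrightarrow> x \<otimes>\<^bsub>M\<^esub> x = x" and y: "y \<in> carrier N"
  shows "y \<otimes>\<^bsub>N\<^esub> y = y"
proof -
  obtain h where h: "h \<in> hom M N" "bij_betw h (carrier M) (carrier N)"
    using assms(1) by (auto simp: is_iso_def iso_def)
  obtain x where "x \<in> carrier M" "y = h x"
    using h(2) y by (auto simp: bij_betw_def)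
  then show ?thesis
    using idem[of x] hom_mult[OF h(1), of x x] by simp
qed

context total_order
begin

lemma meet_idem: "x \<in> carrier L \<Longrightarrow> x \<sqinter> x = x"
  \<comment> \<open>Despite its name, \<open>le_iff_join\<close> describes the order through the
    meet: \<open>x \<sqsubseteq> y\<close> iff \<open>x = x \<sqinter> y\<close>. Reflexivity then
    gives the claim.\<close>
  using le_iff_join[of x x] by simp

text \<open>\<open>\<top>\<close> is defined by \<open>SOME\<close>, so it is a greatest element
  only once one is known to exist. The supremum of the finite nonempty carrier serves as
  witness.\<close>

lemma finite_top_greatest:
  assumes "finite (carrier L)" "carrier L \<noteq> {}"
  shows "greatest L \<top> (carrier L)"
proof -
  have "least L (\<Squnion>carrier L) (Upper L (carrier L))"
    using assms by (intro finite_sup_least) auto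
  then have "greatest L (\<Squnion>carrier L) (carrier L)"
    by (auto simp: greatest_def intro: least_Upper_above finite_sup_closed assms)
  then show ?thesis
    unfolding top_def by (rule someI)
qed

lemma comm_monoid_meet_monoid:
  assumes "finite (carrier L)" "carrier L \<noteq> {}"
  shows "comm_monoid (meet_monoid L)"
proof -
  have top: "\<top> \<in> carrier L" "\<And>x. x \<in> carrier L \<Longrightarrow> x \<sqsubseteq> \<top>"
    using finite_top_greatest[OF assms] by (auto simp: greatest_def)
  show ?thesis
  proof (rule comm_monoidI, simp_all add: meet_monoid_def top)
    show "x \<sqinter> y \<sqinter> z = x \<sqinter> (y \<sqinter> z)" if "x \<in> carrier L" "y \<in> carrier L" "z \<in> carrier L" for x y z
      using that by (rule meet_assoc)
    show "\<top> \<sqinter> x = x" if "x \<in> carrier L" for x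
      using that top le_iff_join[of x \<top>] meet_comm[of L x \<top>] by simp
    show "x \<sqinter> y = y \<sqinter> x" for x y
      by (rule meet_comm)
  qed
qed

end

theorem theorem5p1:
  fixes p :: nat and L :: "('a, 'b) gorder_scheme"
  assumes "Factorial_Ring.prime p" and "p > 2"
    and "total_order L" and "finite (carrier L)" and "card (carrier L) = p"
  shows "comm_monoid (meet_monoid L) \<and>
         (\<forall>x\<in>carrier (meet_monoid L). x \<otimes>\<^bsub>meet_monoid L\<^esub> x = x) \<and>
         (\<forall>(G :: ('v, 'e) pre_digraph) sink.
            sandpile_graph G sink \<longrightarrow> \<not> meet_monoid L \<cong> sandpile_monoid G sink)"
proof (intro conjI allI impI notI)
  interpret L: total_order L by fact
  have "carrier L \<noteq> {}"
    using assms(2,5) by auto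
  then show "comm_monoid (meet_monoid L)"
    using assms(4) L.comm_monoid_meet_monoid by blast
  show idem: "\<forall>x\<in>carrier (meet_monoid L). x \<otimes>\<^bsub>meet_monoid L\<^esub> x = x"
    by (simp add: meet_monoid_def L.meet_idem)
  fix G :: "('v, 'e) pre_digraph" and sink
  assume "sandpile_graph G sink" and iso: "meet_monoid L \<cong> sandpile_monoid G sink"
  then interpret sandpile_graph G sink by simp
  have fin: "finite (nonsink G sink)"
    by (simp add: nonsink_def)
  have prod: "(\<Prod>v\<in>nonsink G sink. out_degree G v) = p"
    using iso_same_card[OF iso] assms(5) by (simp add: card_sandpile_monoid meet_monoid_def)
  then have "(\<Prod>v\<in>nonsink G sink. out_degree G v) \<noteq> 0"
    using assms(2) by simp
  \<comment> \<open>A non-sink vertex of out-degree 0 would make the whole product vanish.\<close>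
  then have pos: "0 < out_degree G u" if "u \<in> nonsink G sink" for u
    using that fin by (simp add: prod_zero_iff)
  obtain v where v: "v \<in> nonsink G sink" "p dvd out_degree G v"
    using prod prime_dvd_prod_iff[OF fin assms(1), of "out_degree G"] by auto
  have "2 < out_degree G v"
    \<comment> \<open>Since 0 is divisible by \<open>p\<close> too, positivity is needed to get from
      divisibility to \<open>p \<le> out_degree G v\<close>.\<close>
    using dvd_imp_le[OF v(2) pos[OF v(1)]] assms(2) by linarith
  then obtain c where "c \<in> carrier (sandpile_monoid G sink)" "c \<otimes>\<^bsub>sandpile_monoid G sink\<^esub> c \<noteq> c"
    using sandpile_monoid_not_idempotent[OF v(1) _ pos] by blast
  then show False
    using iso_preserves_idempotent[OF iso] idem by blast
qed

end
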